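(* On a common probability space, let $N\ge1$ and assume: - $X_1,\dots,X_N$ are real-valued random variables (possibly dependent) and there exist $B>0$, $\alpha>0$, $\beta>0$, $x_0>0$ such that for all $x\ge x_0$ and all $n\in\{1,\dots,N\}$, $\mathbb{P}\{|X_n|\ge x\}\le Be^{-\alpha x^\beta}$. - $\phi_1,\dots,\phi_N$ are jointly independent real-valued random variables with $-1\le\phi_n\le1$ and $\mathbb{E}[\phi_n]=0$ for all $n$. - $A_1,\dots,A_N$ are deterministic real numbers with $0\le A_n\le A$ for all $n$, for a constant $A>0$ independent of $n$. - The set of random variables $\{X_n\}_{n=1}^N$ is independent of the set $\{\phi_n\}_{n=1}^N$. Let $S_N=\sum_{n=1}^NA_nX_n\phi_n$. Then for all $x>0$ with $x\ge x_0^{(2+\beta)/2}$, $$\mathbb{P}\left\{|S_N|\ge\sqrt N\,x\right\}\le2\max[2,NB]\exp\left(-\min\left[\frac1{2A^2},\alpha\right]x^{\frac{2\beta}{2+\beta}}\right).$$ *)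

theory Defs
  imports "HOL-Probability.Probability"
begin

end

theory Submission
  imports Defs
begin

text \<open>
  Truncate at t = x powr (2/(2+\<beta>)): this level balances t powr \<beta> = x^2 / t^2 = x powr (2\<beta>/(2+\<beta>)).
  A union bound controls the event that some \<bar>X n\<bar> is at least t. On the complement,
  freezing the values of the X n (Fubini, by independence of X and \<phi>) leaves a sum of independent
  centred variables with values in [-A t, A t], to which Hoeffding's inequality applies.
\<close>

text \<open>Independence makes the joint law of \<open>X\<close> and \<open>Y\<close> the product of
  their laws, so by Tonelli the probability of \<open>E\<close> is the average, over the law of
  \<open>X\<close>, of the probabilities of the slices at fixed \<open>u\<close>. An average of
  quantities bounded by \<open>c\<close> is bounded by \<open>c\<close>. This is the rigorous form
  of freezing \<open>X\<close>.\<close>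

lemma (in prob_space) indep_var_prob_le_of_slices:
  assumes ind: "indep_var S X T Y"
    and E: "E \<in> sets (S \<Otimes>\<^sub>M T)"
    and slice: "\<And>u. u \<in> space S \<Longrightarrow> prob {\<omega> \<in> space M. (u, Y \<omega>) \<in> E} \<le> c"
  shows "prob {\<omega> \<in> space M. (X \<omega>, Y \<omega>) \<in> E} \<le> c"
proof -
  note [measurable] = E indep_var_rv1[OF ind] indep_var_rv2[OF ind]
  interpret DX: prob_space "distr M S X" by (rule prob_space_distr) measurable
  interpret DY: prob_space "distr M T Y" by (rule prob_space_distr) measurable
  \<comment> \<open>A space carrying a probability measure is nonempty, and the slice bound at any
    one point forces \<open>0 \<le> c\<close>; this is needed to pass from \<open>ennreal c\<close>
    back to the real \<open>c\<close> at the end.\<close>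
  obtain u where u: "u \<in> space S"
    using DX.not_empty by auto
  have c: "0 \<le> c"
    using slice[OF u] measure_nonneg[of M] by (rule order_trans[rotated])
  have prod: "distr M S X \<Otimes>\<^sub>M distr M T Y = distr M (S \<Otimes>\<^sub>M T) (\<lambda>\<omega>. (X \<omega>, Y \<omega>))"
    using ind by (simp add: indep_var_distribution_eq)
  have "emeasure M {\<omega> \<in> space M. (X \<omega>, Y \<omega>) \<in> E} =
      emeasure (distr M S X \<Otimes>\<^sub>M distr M T Y) E"
    unfolding prod by (subst emeasure_distr) (auto intro!: arg_cong[where f="emeasure M"])
  also have "\<dots> = (\<integral>\<^sup>+u. emeasure (distr M T Y) (Pair u -` E) \<partial>distr M S X)"
    by (rule DY.emeasure_pair_measure_alt) simp
  also have "\<dots> \<le> (\<integral>\<^sup>+u. ennreal c \<partial>distr M S X)"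
  proof (rule nn_integral_mono)
    fix u assume "u \<in> space (distr M S X)"
    then have u: "u \<in> space S" by simp
    have "emeasure (distr M T Y) (Pair u -` E) = emeasure M {\<omega> \<in> space M. (u, Y \<omega>) \<in> E}"
      using sets_Pair1[OF E, of u]
      by (subst emeasure_distr) (auto intro!: arg_cong[where f="emeasure M"])
    also have "\<dots> \<le> ennreal c"
      unfolding emeasure_eq_measure using slice[OF u] by (rule ennreal_leI)
    finally show "emeasure (distr M T Y) (Pair u -` E) \<le> ennreal c" .
  qed
  also have "\<dots> = ennreal c"
    using DX.emeasure_space_1 by simp
  finally show ?thesis
    unfolding emeasure_eq_measure using c by simp
qed

lemma (in prob_space) Hoeffding_centred_weighted_sum:
  fixes \<phi> :: "'b \<Rightarrow> 'a \<Rightarrow> real" and w :: "'b \<Rightarrow> real"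
  assumes I: "finite I" "I \<noteq> {}"
    and ind: "indep_vars (\<lambda>_. borel) \<phi> I"
    and bnd: "\<And>i. i \<in> I \<Longrightarrow> AE \<omega> in M. - 1 \<le> \<phi> i \<omega> \<and> \<phi> i \<omega> \<le> 1"
    and mean: "\<And>i. i \<in> I \<Longrightarrow> expectation (\<phi> i) = 0"
    and w: "\<And>i. i \<in> I \<Longrightarrow> \<bar>w i\<bar> \<le> K"
    and K: "K > 0" and \<epsilon>: "\<epsilon> \<ge> 0"
  shows "prob {\<omega> \<in> space M. \<bar>\<Sum>i\<in>I. w i * \<phi> i \<omega>\<bar> \<ge> \<epsilon>}
    \<le> 2 * exp (- \<epsilon>\<^sup>2 / (2 * real (card I) * K\<^sup>2))"
proof -
  interpret H: Hoeffding_ineq M I "\<lambda>i \<omega>. w i * \<phi> i \<omega>" "\<lambda>_. - K" "\<lambda>_. K" 0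
  proof unfold_locales
    show "indep_vars (\<lambda>_. borel) (\<lambda>i \<omega>. w i * \<phi> i \<omega>) I"
      by (rule indep_vars_compose2[OF ind]) simp
    show "AE \<omega> in M. w i * \<phi> i \<omega> \<in> {- K..K}" if i: "i \<in> I" for i
      using bnd[OF i]
    proof eventually_elim
      case (elim \<omega>)
      have "\<bar>w i * \<phi> i \<omega>\<bar> \<le> K * 1"
        unfolding abs_mult using w[OF i] K elim by (intro mult_mono) auto
      then show ?case by (auto simp: abs_le_iff)
    qed
    show "0 \<equiv> \<Sum>i\<in>I. expectation (\<lambda>\<omega>. w i * \<phi> i \<omega>)"
      using mean by (intro eq_reflection) simp
  qed (rule I)
  have card: "real (card I) > 0"
    using I by (simp add: card_gt_0_iff)
  \<comment> \<open>Every range has width \<open>2 * K\<close>; this sum of squared widths is the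
    denominator in Hoeffding's exponent.\<close>
  have eq: "(\<Sum>i\<in>I. (K - - K)\<^sup>2) = 4 * real (card I) * K\<^sup>2"
    by (simp add: power2_eq_square)
  have "prob {\<omega> \<in> space M. \<bar>\<Sum>i\<in>I. w i * \<phi> i \<omega>\<bar> \<ge> \<epsilon>}
    \<le> 2 * exp (- 2 * \<epsilon>\<^sup>2 / (4 * real (card I) * K\<^sup>2))"
    using H.Hoeffding_ineq_abs_ge[OF \<epsilon>] card K unfolding eq by simp
  then show ?thesis by (simp add: mult.assoc)
qed

theorem theorem10:
  fixes M :: "'a measure" and N :: nat
    and X \<phi> :: "nat \<Rightarrow> 'a \<Rightarrow> real"
    and a :: "nat \<Rightarrow> real"
    and A B \<alpha> \<beta> x\<^sub>0 x :: real
  assumes "prob_space M"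
    and "N \<ge> 1"
    and "\<And>n. n \<in> {1..N} \<Longrightarrow> X n \<in> borel_measurable M"
    and "B > 0" and "\<alpha> > 0" and "\<beta> > 0" and "x\<^sub>0 > 0"
    and "\<And>y n. y \<ge> x\<^sub>0 \<Longrightarrow> n \<in> {1..N} \<Longrightarrow>
           \<P>(\<omega> in M. \<bar>X n \<omega>\<bar> \<ge> y) \<le> B * exp (- \<alpha> * y powr \<beta>)"
    and "prob_space.indep_vars M (\<lambda>_. borel) \<phi> {1..N}"
    and "\<And>n. n \<in> {1..N} \<Longrightarrow> AE \<omega> in M. - 1 \<le> \<phi> n \<omega> \<and> \<phi> n \<omega> \<le> 1"
    and "\<And>n. n \<in> {1..N} \<Longrightarrow> (\<integral>\<omega>. \<phi> n \<omega> \<partial>M) = 0"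
    and "A > 0"
    and "\<And>n. n \<in> {1..N} \<Longrightarrow> 0 \<le> a n \<and> a n \<le> A"
    and "prob_space.indep_var M
           (Pi\<^sub>M {1..N} (\<lambda>_. borel)) (\<lambda>\<omega>. \<lambda>n\<in>{1..N}. X n \<omega>)
           (Pi\<^sub>M {1..N} (\<lambda>_. borel)) (\<lambda>\<omega>. \<lambda>n\<in>{1..N}. \<phi> n \<omega>)"
    and "x > 0" and "x \<ge> x\<^sub>0 powr ((2 + \<beta>) / 2)"
  shows "\<P>(\<omega> in M. \<bar>\<Sum>n=1..N. a n * X n \<omega> * \<phi> n \<omega>\<bar> \<ge> sqrt (real N) * x)
    \<le> 2 * max 2 (real N * B)
        * exp (- min (1 / (2 * A\<^sup>2)) \<alpha> * x powr (2 * \<beta> / (2 + \<beta>)))"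
proof -
  interpret prob_space M by fact
  note X_meas = assms(3) and tail = assms(8) and ind_\<phi> = assms(9) and \<phi>_bnd = assms(10)
    and \<phi>_mean = assms(11) and a_bnd = assms(13) and ind = assms(14)
  define t where "t = x powr (2 / (2 + \<beta>))"
  define E where "E = x powr (2 * \<beta> / (2 + \<beta>))"
  define m where "m = min (1 / (2 * A\<^sup>2)) \<alpha>"
  have t: "t > 0" and E: "E > 0"
    using \<open>x > 0\<close> by (simp_all add: t_def E_def)
  \<comment> \<open>Raising to the power \<open>2 / (2 + \<beta>)\<close> undoes the exponent in the
    lower bound on \<open>x\<close>, so the truncation level \<open>t\<close> lies where the tail
    hypothesis applies.\<close>
  have "(x\<^sub>0 powr ((2 + \<beta>) / 2)) powr (2 / (2 + \<beta>)) \<le> t"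
    unfolding t_def using \<open>x\<^sub>0 powr _ \<le> x\<close> \<open>\<beta> > 0\<close> by (intro powr_mono2) auto
  moreover have "(2 + \<beta>) / 2 * (2 / (2 + \<beta>)) = 1"
    using \<open>\<beta> > 0\<close> by (simp add: field_simps)
  ultimately have x\<^sub>0_le: "x\<^sub>0 \<le> t"
    using \<open>x\<^sub>0 > 0\<close> by (simp only: powr_powr) simp
  have t_powr: "t powr \<beta> = E"
    by (simp add: t_def E_def powr_powr)
  have "t\<^sup>2 * E = x powr (2 / (2 + \<beta>) + 2 / (2 + \<beta>) + 2 * \<beta> / (2 + \<beta>))"
    by (simp only: t_def E_def power2_eq_square powr_add)
  also have "2 / (2 + \<beta>) + 2 / (2 + \<beta>) + 2 * \<beta> / (2 + \<beta>) = 2"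
    using \<open>\<beta> > 0\<close> by (simp add: divide_simps) (simp add: algebra_simps)
  finally have t_sq: "t\<^sup>2 * E = x\<^sup>2"
    using \<open>x > 0\<close> by simp

  have [measurable]: "random_variable borel (X n)" "random_variable borel (\<phi> n)" if "n \<in> {1..N}" for n
    using X_meas[OF that] ind_\<phi> that by (auto simp: indep_vars_def)
  \<comment> \<open>The truncation is built into \<open>F\<close>, as a set of pairs of vectors:
    slices at a \<open>u\<close> with some large coordinate are empty, and all others have weights
    \<open>a n * u n\<close> bounded by \<open>A * t\<close>.\<close>
  define F where "F = {p \<in> space (Pi\<^sub>M {1..N} (\<lambda>_. borel) \<Otimes>\<^sub>M Pi\<^sub>M {1..N} (\<lambda>_. borel)).
    (\<forall>n\<in>{1..N}. \<bar>fst p n\<bar> < t) \<and> sqrt (real N) * x \<le> \<bar>\<Sum>n=1..N. a n * fst p n * snd p n\<bar>}"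
  have F: "F \<in> sets (Pi\<^sub>M {1..N} (\<lambda>_. borel :: real measure) \<Otimes>\<^sub>M Pi\<^sub>M {1..N} (\<lambda>_. borel))"
    unfolding F_def by measurable
  let ?X = "\<lambda>\<omega>. \<lambda>n\<in>{1..N}. X n \<omega>" and ?\<phi> = "\<lambda>\<omega>. \<lambda>n\<in>{1..N}. \<phi> n \<omega>"

  have slice: "prob {\<omega> \<in> space M. (u, ?\<phi> \<omega>) \<in> F} \<le> 2 * exp (- E / (2 * A\<^sup>2))" for u
  proof (cases "\<forall>n\<in>{1..N}. \<bar>u n\<bar> < t")
    case True
    have "prob {\<omega> \<in> space M. (u, ?\<phi> \<omega>) \<in> F}
        \<le> prob {\<omega> \<in> space M. \<bar>\<Sum>n\<in>{1..N}. a n * u n * \<phi> n \<omega>\<bar> \<ge> sqrt (real N) * x}"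
      by (intro finite_measure_mono) (auto simp: F_def)
    also have "\<dots> \<le> 2 * exp (- (sqrt (real N) * x)\<^sup>2 / (2 * real (card {1..N}) * (A * t)\<^sup>2))"
    proof (rule Hoeffding_centred_weighted_sum[OF _ _ ind_\<phi>])
      show "\<bar>a n * u n\<bar> \<le> A * t" if "n \<in> {1..N}" for n
        unfolding abs_mult using True a_bnd[OF that] that by (intro mult_mono) (auto intro: less_imp_le)
    qed (use \<phi>_bnd \<phi>_mean \<open>N \<ge> 1\<close> \<open>A > 0\<close> \<open>x > 0\<close> t in auto)
    also have "(sqrt (real N) * x)\<^sup>2 = real N * (t\<^sup>2 * E)"
      by (simp add: power_mult_distrib t_sq)
    \<comment> \<open>The factor \<open>real N\<close> cancels against the number of summands and
      \<open>t\<^sup>2\<close> against the squared weight bound; what remains of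
      \<open>x\<^sup>2\<close> is \<open>E\<close>.\<close>
    also have "- (real N * (t\<^sup>2 * E)) / (2 * real (card {1..N}) * (A * t)\<^sup>2) = - E / (2 * A\<^sup>2)"
      using \<open>N \<ge> 1\<close> \<open>A > 0\<close> t by (simp add: field_simps power_mult_distrib)
    finally show ?thesis .
  next
    case False
    then have "{\<omega> \<in> space M. (u, ?\<phi> \<omega>) \<in> F} = {}"
      by (auto simp: F_def)
    then show ?thesis
      by (simp only: measure_empty) simp
  qed

  note F[measurable] indep_var_rv1[OF ind, measurable] indep_var_rv2[OF ind, measurable]
  have meas: "{\<omega> \<in> space M. (?X \<omega>, ?\<phi> \<omega>) \<in> F} \<in> events"
    "\<And>n. n \<in> {1..N} \<Longrightarrow> {\<omega> \<in> space M. \<bar>X n \<omega>\<bar> \<ge> t} \<in> events"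
    by measurable
  \<comment> \<open>Either every \<open>\<bar>X n \<omega>\<bar>\<close> is below \<open>t\<close>,
    and the pair of vectors lies in \<open>F\<close>, or some
    \<open>\<bar>X n \<omega>\<bar>\<close> reaches \<open>t\<close>.\<close>
  have "{\<omega> \<in> space M. \<bar>\<Sum>n=1..N. a n * X n \<omega> * \<phi> n \<omega>\<bar> \<ge> sqrt (real N) * x}
      \<subseteq> {\<omega> \<in> space M. (?X \<omega>, ?\<phi> \<omega>) \<in> F} \<union> (\<Union>n\<in>{1..N}. {\<omega> \<in> space M. \<bar>X n \<omega>\<bar> \<ge> t})"
    by (auto simp: F_def space_pair_measure space_PiM not_le)
  then have "prob {\<omega> \<in> space M. \<bar>\<Sum>n=1..N. a n * X n \<omega> * \<phi> n \<omega>\<bar> \<ge> sqrt (real N) * x}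
      \<le> prob ({\<omega> \<in> space M. (?X \<omega>, ?\<phi> \<omega>) \<in> F} \<union> (\<Union>n\<in>{1..N}. {\<omega> \<in> space M. \<bar>X n \<omega>\<bar> \<ge> t}))"
    using meas by (intro finite_measure_mono) auto
  also have "\<dots> \<le> prob {\<omega> \<in> space M. (?X \<omega>, ?\<phi> \<omega>) \<in> F}
      + prob (\<Union>n\<in>{1..N}. {\<omega> \<in> space M. \<bar>X n \<omega>\<bar> \<ge> t})"
    using meas by (intro measure_Un_le) auto
  also have "\<dots> \<le> 2 * exp (- E / (2 * A\<^sup>2)) + (\<Sum>n\<in>{1..N}. prob {\<omega> \<in> space M. \<bar>X n \<omega>\<bar> \<ge> t})"
    by (intro add_mono indep_var_prob_le_of_slices[OF ind F slice] measure_UNION_le meas) auto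
  \<comment> \<open>The tail hypothesis is used at \<open>y = t\<close>, where
    \<open>t powr \<beta> = E\<close> gives the same power of \<open>x\<close> as the Hoeffding
    term.\<close>
  also have "\<dots> \<le> 2 * exp (- E / (2 * A\<^sup>2)) + (\<Sum>n\<in>{1..N}. B * exp (- \<alpha> * E))"
    using tail[OF x\<^sub>0_le] unfolding t_powr by (intro add_left_mono sum_mono) auto
  also have "\<dots> = 2 * exp (- (1 / (2 * A\<^sup>2)) * E) + real N * B * exp (- \<alpha> * E)"
    by simp
  \<comment> \<open>Both rates are at least \<open>m\<close> and \<open>E\<close> is positive, so
    each exponential only grows when its rate is lowered to \<open>m\<close>.\<close>
  also have "\<dots> \<le> 2 * exp (- m * E) + real N * B * exp (- m * E)"
    using E \<open>B > 0\<close>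
    by (intro add_mono mult_left_mono iffD2[OF exp_le_cancel_iff] mult_right_mono)
       (auto simp: m_def)
  also have "\<dots> = (2 + real N * B) * exp (- m * E)"
    by (simp add: algebra_simps)
  \<comment> \<open>A sum of two numbers is at most twice their maximum.\<close>
  also have "\<dots> \<le> 2 * max 2 (real N * B) * exp (- m * E)"
    by (intro mult_right_mono) auto
  finally show ?thesis
    unfolding m_def E_def .
qed

end
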